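(* (i) There is an algorithm which, for a tropical algebraic function $f$ with $k$ tropical roots, yields a decomposition (with respect to composition of functions) of $f$ into $k$ tropical algebraic binomials. (ii) Let $f$ be a tropical monotone algebraic rational function with $k$ tropical roots. Then the algorithm yields a decomposition (with respect to composition) of $f$ into $k$ tropical monotone algebraic rational binomials.
   Context: A tropical algebraic function is a function $\mathbb{R}\to\mathbb{R}$ of the form $\min_i\{b_ix+a_i\}$ (a finite minimum) with $0\le b_i\in\mathbb{Q}$ and $a_i\in\mathbb{R}$. A tropical algebraic rational function is a difference of two tropical algebraic functions; it is a continuous piecewise linear function with finitely many linear pieces, whose slopes are rational. A tropical root is a point at which the function is not differentiable. A tropical algebraic rational function is monotone increasing (respectively, decreasing) if all slopes of its linear pieces are positive (respectively, negative). A tropical algebraic rational binomial is a function of the form either $\min\{b_1x+a_1,\,b_2x+a_2\}$ or $\max\{b_1x+a_1,\,b_2x+a_2\}$ with nonzero $b_1,b_2\in\mathbb{Q}$ and $a_1,a_2\in\mathbb{R}$, having two (unbounded) linear pieces. In the former case (the minimum) it is called a tropical algebraic binomial. It is monotone if all its slopes are positive or all are negative; if $b_1,b_2>0$, it is monotone increasing.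
   Formalization: At least one tropical root (k ≥ 1) is assumed, since 2x is no empty composition; in (i), if f has a constant piece (as min{x,0}, no composition of binomials with nonzero slopes), the outermost factor may be min{bx+a, a'} with b > 0. *)

theory Defs
  imports Complex_Main
begin

section \<open>Tropical algebraic functions\<close>

text \<open>A finite family of linear forms \<open>b * x + a\<close> is given as the list of its pairs \<open>(b, a)\<close>.\<close>

type_synonym linear_forms = "(rat \<times> real) list"

definition tropical_algebraic :: "linear_forms \<Rightarrow> (real \<Rightarrow> real) \<Rightarrow> bool" where
  "tropical_algebraic p f \<longleftrightarrow> p \<noteq> [] \<and> (\<forall>(b, a)\<in>set p. 0 \<le> b) \<and>
     f = (\<lambda>x. Min ((\<lambda>(b, a). of_rat b * x + a) ` set p))"

definition tropical_algebraic_rational ::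
    "linear_forms \<Rightarrow> linear_forms \<Rightarrow> (real \<Rightarrow> real) \<Rightarrow> bool" where
  "tropical_algebraic_rational p q f \<longleftrightarrow>
     (\<exists>g h. tropical_algebraic p g \<and> tropical_algebraic q h \<and> f = (\<lambda>x. g x - h x))"

definition tropical_roots :: "(real \<Rightarrow> real) \<Rightarrow> real set" where
  "tropical_roots f = {x. \<not> f differentiable at x}"

definition slopes :: "(real \<Rightarrow> real) \<Rightarrow> real set" where
  "slopes f = {m. \<exists>l u c. l < u \<and> (\<forall>x\<in>{l<..<u}. f x = m * x + c)}"

definition tropical_increasing :: "(real \<Rightarrow> real) \<Rightarrow> bool" where
  "tropical_increasing f \<longleftrightarrow> (\<forall>m\<in>slopes f. 0 < m)"

definition tropical_decreasing :: "(real \<Rightarrow> real) \<Rightarrow> bool" where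
  "tropical_decreasing f \<longleftrightarrow> (\<forall>m\<in>slopes f. m < 0)"


section \<open>Binomials and composition\<close>

datatype extremum = Minimum | Maximum

datatype binomial = Binomial (kind: extremum)
  (slope1: rat) (const1: real) (slope2: rat) (const2: real)

fun binomial_fun :: "binomial \<Rightarrow> real \<Rightarrow> real" where
  "binomial_fun (Binomial Minimum b1 a1 b2 a2) x = min (of_rat b1 * x + a1) (of_rat b2 * x + a2)"
| "binomial_fun (Binomial Maximum b1 a1 b2 a2) x = max (of_rat b1 * x + a1) (of_rat b2 * x + a2)"

text \<open>The condition \<open>slope1 B \<noteq> slope2 B\<close> says that the function has two linear pieces.\<close>

definition rational_binomial :: "binomial \<Rightarrow> bool" where
  "rational_binomial B \<longleftrightarrow> slope1 B \<noteq> 0 \<and> slope2 B \<noteq> 0 \<and> slope1 B \<noteq> slope2 B"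

definition algebraic_binomial :: "binomial \<Rightarrow> bool" where
  "algebraic_binomial B \<longleftrightarrow> rational_binomial B \<and> kind B = Minimum"

definition monotone_rational_binomial :: "binomial \<Rightarrow> bool" where
  "monotone_rational_binomial B \<longleftrightarrow> rational_binomial B \<and>
     (0 < slope1 B \<and> 0 < slope2 B \<or> slope1 B < 0 \<and> slope2 B < 0)"

text \<open>
  A tropical algebraic function may be eventually constant, since the slope \<open>0\<close> is allowed, e.g.
  \<open>min x 0\<close>. A composition of binomials with nonzero slopes never has a constant piece, so
  such a function needs one factor of the form \<open>min (b * x + a) a'\<close> with \<open>b > 0\<close>.
\<close>

definition half_constant_binomial :: "binomial \<Rightarrow> bool" where
  "half_constant_binomial B \<longleftrightarrow> kind B = Minimum \<and>
     (slope1 B = 0 \<and> 0 < slope2 B \<or> 0 < slope1 B \<and> slope2 B = 0)"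

text \<open>The head of the list is the outermost factor; the empty composition is the identity.\<close>

definition compose :: "binomial list \<Rightarrow> real \<Rightarrow> real" where
  "compose Bs = foldr (\<circ>) (map binomial_fun Bs) id"


section \<open>Algorithms over the reals\<close>

text \<open>
  Since the input contains arbitrary real numbers, an algorithm is understood in the sense of
  exact real arithmetic (real RAM, Blum--Shub--Smale): the field operations and the comparison
  \<open><\<close> are the elementary steps. Only rational constants may occur in a program.
  A program is a finite list of bodies of mutually recursive first-order functions on data built
  from real numbers by pairing; \<open>Var i\<close> is the \<open>i\<close>-th argument of the current function.
\<close>

datatype val = Num real | Null | Cell val val

datatype arith = Add | Sub | Mul | Div

datatype tm =
    Var nat
  | Const rat
  | Empty
  | MkPair tm tm
  | First tm
  | Second tm
  | Arith arith tm tm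
  | IfLess tm tm tm tm
  | IfPair tm tm tm
  | Call nat "tm list"

fun arith_fun :: "arith \<Rightarrow> real \<Rightarrow> real \<Rightarrow> real" where
  "arith_fun Add x y = x + y"
| "arith_fun Sub x y = x - y"
| "arith_fun Mul x y = x * y"
| "arith_fun Div x y = x / y"

text \<open>
  Evaluation under a program and a list of arguments. An ill-typed operation, an undefined
  variable or function, or a division by \<open>0\<close> has no result, and neither has a computation that
  does not terminate.
\<close>

inductive evaluates :: "tm list \<Rightarrow> val list \<Rightarrow> tm \<Rightarrow> val \<Rightarrow> bool" for P where
  Var: "i < length env \<Longrightarrow> evaluates P env (Var i) (env ! i)"
| Const: "evaluates P env (Const c) (Num (of_rat c))"
| Empty: "evaluates P env Empty Null"
| MkPair: "evaluates P env s v \<Longrightarrow> evaluates P env t w \<Longrightarrow>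
    evaluates P env (MkPair s t) (Cell v w)"
| First: "evaluates P env t (Cell v w) \<Longrightarrow> evaluates P env (First t) v"
| Second: "evaluates P env t (Cell v w) \<Longrightarrow> evaluates P env (Second t) w"
| Arith: "evaluates P env s (Num x) \<Longrightarrow> evaluates P env t (Num y) \<Longrightarrow> (op = Div \<longrightarrow> y \<noteq> 0) \<Longrightarrow>
    evaluates P env (Arith op s t) (Num (arith_fun op x y))"
| IfLess_true: "evaluates P env s (Num x) \<Longrightarrow> evaluates P env t (Num y) \<Longrightarrow> x < y \<Longrightarrow>
    evaluates P env u v \<Longrightarrow> evaluates P env (IfLess s t u u') v"
| IfLess_false: "evaluates P env s (Num x) \<Longrightarrow> evaluates P env t (Num y) \<Longrightarrow> \<not> x < y \<Longrightarrow>
    evaluates P env u' v \<Longrightarrow> evaluates P env (IfLess s t u u') v"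
| IfPair_true: "evaluates P env s (Cell w w') \<Longrightarrow> evaluates P env u v \<Longrightarrow>
    evaluates P env (IfPair s u u') v"
| IfPair_false: "evaluates P env s w \<Longrightarrow> (\<nexists>w1 w2. w = Cell w1 w2) \<Longrightarrow> evaluates P env u' v \<Longrightarrow>
    evaluates P env (IfPair s u u') v"
| Call: "i < length P \<Longrightarrow> list_all2 (evaluates P env) ts vs \<Longrightarrow> evaluates P vs (P ! i) v \<Longrightarrow>
    evaluates P env (Call i ts) v"

text \<open>The first function of a program is its entry point.\<close>

definition yields :: "tm list \<Rightarrow> val \<Rightarrow> val \<Rightarrow> bool" where
  "yields P v w \<longleftrightarrow> evaluates P [v] (Call 0 [Var 0]) w"

inductive_cases evaluates_elims:
  "evaluates P env (Var i) w"
  "evaluates P env (Const c) w"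
  "evaluates P env Empty w"
  "evaluates P env (MkPair s t) w"
  "evaluates P env (First t) w"
  "evaluates P env (Second t) w"
  "evaluates P env (Arith op s t) w"
  "evaluates P env (IfLess s t u u') w"
  "evaluates P env (IfPair s u u') w"
  "evaluates P env (Call i ts) w"

lemma evaluates_deterministic:
  "evaluates P env t v \<Longrightarrow> evaluates P env t w \<Longrightarrow> v = w"
proof (induction arbitrary: w rule: evaluates.induct)
  case (Call i env ts vs v)
  from Call.prems obtain vs' where vs': "list_all2 (evaluates P env) ts vs'"
    and w: "evaluates P vs' (P ! i) w"
    by (rule evaluates_elims(10))
  have "length vs' = length vs"
    using Call.IH(1) vs' by (simp add: list_all2_conv_all_nth)
  moreover have "vs' ! j = vs ! j" if "j < length vs'" for j
    using list_all2_nthD2[OF Call.IH(1)] list_all2_nthD2[OF vs' that] that calculation by metis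
  ultimately have "vs' = vs" by (rule nth_equalityI)
  with w show ?case by (auto intro: Call.IH(2))
next
  case (MkPair env s v t w')
  from MkPair.prems show ?case
    by (rule evaluates_elims(4)) (drule MkPair.IH(1), drule MkPair.IH(2), simp)
next
  case (First env t v v')
  from First.prems show ?case by (rule evaluates_elims(5)) (drule First.IH, simp)
next
  case (Second env t v v')
  from Second.prems show ?case by (rule evaluates_elims(6)) (drule Second.IH, simp)
next
  case (Arith env s x t y op)
  from Arith.prems show ?case
    by (rule evaluates_elims(7)) (drule Arith.IH(1), drule Arith.IH(2), simp)
next
  case (IfLess_true env s x t y u v u')
  from IfLess_true.prems show ?case
    by (rule evaluates_elims(8))
       (drule IfLess_true.IH(1), drule IfLess_true.IH(2), rule IfLess_true.IH(3),
        use IfLess_true.hyps(3) in simp)+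
next
  case (IfLess_false env s x t y u' v u)
  from IfLess_false.prems show ?case
    by (rule evaluates_elims(8))
       (drule IfLess_false.IH(1), drule IfLess_false.IH(2), rule IfLess_false.IH(3),
        use IfLess_false.hyps(3) in simp)+
next
  case (IfPair_true env s w1 w2 u v u')
  from IfPair_true.prems show ?case
  proof (rule evaluates_elims(9))
    assume "evaluates P env u w"
    then show ?thesis by (rule IfPair_true.IH(2))
  next
    fix w'
    assume "evaluates P env s w'" "\<forall>w1 w2. w' \<noteq> Cell w1 w2"
    with IfPair_true.IH(1) show ?thesis by blast
  qed
next
  case (IfPair_false env s w1 u' v u)
  from IfPair_false.prems show ?case
  proof (rule evaluates_elims(9))
    fix w2 w3
    assume "evaluates P env s (Cell w2 w3)"
    then have "w1 = Cell w2 w3" by (rule IfPair_false.IH(1))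
    with IfPair_false.hyps(2) show ?thesis by blast
  next
    assume "evaluates P env u' w"
    then show ?thesis by (rule IfPair_false.IH(2))
  qed
next
  case (Var i env)
  from Var.prems show ?case by (rule evaluates_elims(1)) simp
next
  case (Const env c)
  from Const.prems show ?case by (rule evaluates_elims(2)) simp
next
  case (Empty env)
  from Empty.prems show ?case by (rule evaluates_elims(3)) simp
qed

lemma yields_deterministic: "yields P v w \<Longrightarrow> yields P v w' \<Longrightarrow> w = w'"
  unfolding yields_def by (rule evaluates_deterministic)


section \<open>Input and output data\<close>

fun list_val :: "val list \<Rightarrow> val" where
  "list_val [] = Null"
| "list_val (v # vs) = Cell v (list_val vs)"

definition forms_val :: "linear_forms \<Rightarrow> val" where
  "forms_val p = list_val (map (\<lambda>(b, a). Cell (Num (of_rat b)) (Num a)) p)"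

definition input_val :: "linear_forms \<Rightarrow> linear_forms \<Rightarrow> val" where
  "input_val p q = Cell (forms_val p) (forms_val q)"

fun binomial_val :: "binomial \<Rightarrow> val" where
  "binomial_val (Binomial e b1 a1 b2 a2) =
     list_val [Num (case e of Minimum \<Rightarrow> 0 | Maximum \<Rightarrow> 1),
               Num (of_rat b1), Num a1, Num (of_rat b2), Num a2]"

definition output_val :: "binomial list \<Rightarrow> val" where
  "output_val Bs = list_val (map binomial_val Bs)"

text \<open>The tropical zero-function \<open>0 * x + 0\<close>; \<open>input_val p zero_form\<close> presents \<open>p\<close> as \<open>p - 0\<close>.\<close>

definition zero_form :: linear_forms where
  "zero_form = [(0, 0)]"

end

theory Submission
  imports Defs
begin

text \<open>
  A tropical rational function \<open>f\<close> is a broken line: it is given by its leftmost linear piece and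
  by its roots \<open>t\<^sub>1 < \<dots> < t\<^sub>k\<close> with the jumps of the slope there. Let \<open>m\<^sub>0, \<dots>, m\<^sub>k\<close> be the slopes
  of its pieces and suppose that \<open>m\<^sub>0, \<dots>, m\<^bsub>k-1\<^esub>\<close> are nonzero and of the same sign. If \<open>k > 1\<close>,
  let \<open>g\<close> agree with \<open>f\<close> right of \<open>t\<^sub>1\<close> and continue the piece of slope \<open>m\<^sub>1\<close> to the left. Then
  \<open>f = g \<circ> B\<close>, where \<open>B\<close> is the identity right of \<open>t\<^sub>1\<close> and stretches the left half-line about
  \<open>t\<^sub>1\<close> by \<open>\<rho> = m\<^sub>0 / m\<^sub>1 > 0\<close>. This \<open>B\<close> is a monotone increasing binomial, a minimum if \<open>\<rho> > 1\<close>
  and a maximum if \<open>\<rho> < 1\<close>, and \<open>g\<close> has only the roots \<open>t\<^sub>2, \<dots>, t\<^sub>k\<close>. After \<open>k - 1\<close> such steps a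
  function with one root is left; it is itself a binomial with slopes \<open>m\<^bsub>k-1\<^esub>\<close> and \<open>m\<^sub>k\<close>, and
  becomes the outermost factor (\<open>compose_factors\<close>).

  If \<open>f\<close> is monotone, all slopes have the same sign and all factors are monotone
  (\<open>monotone_factors\<close>). If \<open>f\<close> is a tropical algebraic function, it is concave with nonnegative
  slopes; so only \<open>m\<^sub>k\<close> can vanish, every ratio exceeds \<open>1\<close>, and all factors are minima
  (\<open>concave_factors\<close>).

  To find the broken line from the linear forms, note that a minimum of linear forms can change
  its slope only where two of them cross. So the program sorts the abscissas of all pairwise
  crossings, and computes at each of them the left and right slopes of both minima: these are the
  largest and the smallest slope of a form that attains the minimum there (\<open>scan_sound\<close>). The
  crossings at which the jump of the difference does not vanish are the roots. That the resulting
  broken line is equal to \<open>f\<close> is proved locally: the difference of the two has no kink, so that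
  its derivative is locally constant and it is affine (\<open>kink_free_imp_affine\<close>), and near the first
  root it is zero (\<open>difference_eq_broken_line\<close>).

  The program follows these computations function by function. Every recursion runs along a list, so
  that its correctness is shown by induction with symbolic evaluation
  (\<open>program_yields_decomposition\<close>).
\<close>

section \<open>One-sided slopes\<close>

text \<open>
  Near \<open>x\<close> the graph of \<open>f\<close> consists of two segments, of slope \<open>l\<close> on the left and \<open>r\<close> on the
  right. Both sides are expressed with the same \<open>h \<rightarrow> 0+\<close>, so that germs are combined by
  intersecting one eventuality.
\<close>

definition germ :: "(real \<Rightarrow> real) \<Rightarrow> real \<Rightarrow> real \<Rightarrow> real \<Rightarrow> bool" where
  "germ f x l r \<longleftrightarrow> (\<forall>\<^sub>F h in at_right 0. f (x + h) = f x + r * h \<and> f (x - h) = f x - l * h)"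

lemma germ_affine: "germ (\<lambda>x. b * x + a) x b b"
  unfolding germ_def by (simp add: algebra_simps)

lemma germ_add:
  assumes "germ f x l r" "germ g x l' r'"
  shows "germ (\<lambda>x. f x + g x) x (l + l') (r + r')"
  using assms unfolding germ_def by eventually_elim (simp add: algebra_simps)

lemma germ_diff:
  assumes "germ f x l r" "germ g x l' r'"
  shows "germ (\<lambda>x. f x - g x) x (l - l') (r - r')"
  using assms unfolding germ_def by eventually_elim (simp add: algebra_simps)

lemma germ_min_less:
  assumes f: "germ f x l r" and g: "germ g x l' r'" and less: "f x < g x"
  shows "germ (\<lambda>x. min (f x) (g x)) x l r"
proof -
  have *: "\<forall>\<^sub>F h in at_right 0. s * h < g x - f x" for s :: real
  proof (rule order_tendstoD)
    show "((\<lambda>h. s * h) \<longlongrightarrow> s * 0) (at_right 0)" by (intro tendsto_intros)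
  qed (use less in simp)
  from f g *[of "r - r'"] *[of "l' - l"] show ?thesis
    unfolding germ_def
    by eventually_elim (use less in \<open>simp add: algebra_simps\<close>)
qed

text \<open>
  At a crossing the smaller function right of \<open>x\<close> is the one of smaller slope, and left of \<open>x\<close> the
  one of larger slope.
\<close>

lemma germ_min_eq:
  assumes f: "germ f x l r" and g: "germ g x l' r'" and eq: "f x = g x"
  shows "germ (\<lambda>x. min (f x) (g x)) x (max l l') (min r r')"
proof -
  have "\<forall>\<^sub>F h in at_right 0. 0 < (h::real)" by (rule eventually_at_right_less)
  with f g show ?thesis
    unfolding germ_def
  proof eventually_elim
    case (elim h)
    have "min r r' * h = min (r * h) (r' * h)" "max l l' * h = max (l * h) (l' * h)"
      using elim(3) by (simp_all add: min_mult_distrib_right max_mult_distrib_right)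
    with elim eq show ?case by (simp add: min_def max_def)
  qed
qed

lemma germ_has_derivative_iff:
  assumes "germ f x l r"
  shows "(f has_real_derivative D) (at x) \<longleftrightarrow> l = D \<and> r = D"
proof -
  have nz: "\<forall>\<^sub>F h in at_right 0. 0 < (h::real)" by (rule eventually_at_right_less)
  from assms nz have quotients: "\<forall>\<^sub>F h in at_right 0. (f (x + h) - f x) / h = r"
    "\<forall>\<^sub>F h in at_right 0. (f (x + - h) - f x) / - h = l"
    unfolding germ_def by (eventually_elim, simp)+
  have "((\<lambda>h. (f (x + h) - f x) / h) \<longlongrightarrow> D) (at_right 0) \<longleftrightarrow> r = D"
    using tendsto_cong[OF quotients(1), of D] by (simp add: tendsto_const_iff)
  moreover have "((\<lambda>h. (f (x + h) - f x) / h) \<longlongrightarrow> D) (at_left 0) \<longleftrightarrow>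
      ((\<lambda>h. (f (x + - h) - f x) / - h) \<longlongrightarrow> D) (at_right 0)"
    by (simp add: filterlim_at_left_to_right[where a = "0::real"])
  moreover have "\<dots> \<longleftrightarrow> l = D"
    using tendsto_cong[OF quotients(2), of D] by (simp add: tendsto_const_iff)
  ultimately show ?thesis
    unfolding DERIV_def filterlim_at_split by blast
qed

text \<open>
  This turns the analytic notion of a tropical root into a comparison of two slopes, which a
  program can carry out.
\<close>

lemma germ_imp_root_iff:
  assumes "germ f x l r"
  shows "x \<in> tropical_roots f \<longleftrightarrow> l \<noteq> r"
  using germ_has_derivative_iff[OF assms] by (auto simp: tropical_roots_def real_differentiable_def)

text \<open>
  The jump of the slope at \<open>x\<close>. It forgets the slopes themselves, and so a piecewise linear
  function is determined by its jumps up to an affine summand.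
\<close>

definition kink :: "(real \<Rightarrow> real) \<Rightarrow> real \<Rightarrow> real \<Rightarrow> bool" where
  "kink f x j \<longleftrightarrow> (\<exists>l. germ f x l (l + j))"

lemma germ_imp_kink: "germ f x l r \<Longrightarrow> kink f x (r - l)"
  unfolding kink_def by (intro exI[of _ l]) simp

lemma kink_add:
  assumes "kink f x j" "kink g x j'"
  shows "kink (\<lambda>x. f x + g x) x (j + j')"
proof -
  from assms obtain l l' where "germ f x l (l + j)" "germ g x l' (l' + j')"
    unfolding kink_def by blast
  from germ_imp_kink[OF germ_add[OF this]] show ?thesis by (simp add: algebra_simps)
qed

lemma kink_diff:
  assumes "kink f x j" "kink g x j'"
  shows "kink (\<lambda>x. f x - g x) x (j - j')"
proof -
  from assms obtain l l' where "germ f x l (l + j)" "germ g x l' (l' + j')"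
    unfolding kink_def by blast
  from germ_imp_kink[OF germ_diff[OF this]] show ?thesis by simp
qed

lemma kink_affine: "kink (\<lambda>x. b * x + a) x 0"
  using germ_imp_kink[OF germ_affine] by simp

lemma kink_ramp: "kink (\<lambda>x. j * max 0 (x - t)) x (if x = t then j else 0)"
proof -
  consider "x < t" | "x = t" | "t < x" by linarith
  then show ?thesis
  proof cases
    case 1
    have "\<forall>\<^sub>F h in at_right 0. 0 < h \<and> h < t - x"
      using 1 by (simp add: eventually_at_right_field) (metis diff_gt_0_iff_gt)
    then have "germ (\<lambda>x. j * max 0 (x - t)) x 0 0"
      unfolding germ_def by eventually_elim (use 1 in simp)
    with germ_imp_kink[OF this] 1 show ?thesis by simp
  next
    case 2
    have "\<forall>\<^sub>F h in at_right 0. 0 < (h::real)" by (rule eventually_at_right_less)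
    then have "germ (\<lambda>x. j * max 0 (x - t)) x 0 j"
      unfolding germ_def by eventually_elim (use 2 in simp)
    with germ_imp_kink[OF this] 2 show ?thesis by simp
  next
    case 3
    have "\<forall>\<^sub>F h in at_right 0. 0 < h \<and> h < x - t"
      using 3 by (simp add: eventually_at_right_field) (metis diff_gt_0_iff_gt)
    then have "germ (\<lambda>x. j * max 0 (x - t)) x j j"
      unfolding germ_def by eventually_elim (use 3 in \<open>simp add: algebra_simps\<close>)
    with germ_imp_kink[OF this] 3 show ?thesis by simp
  qed
qed

text \<open>
  If the slope jumps nowhere, it is a locally constant derivative, hence constant. This local
  argument replaces any induction along the linear pieces of \<open>f\<close>.
\<close>

lemma kink_free_imp_affine:
  assumes "\<And>x. kink f x 0"
  shows "\<exists>b a. \<forall>x. f x = b * x + a"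
proof -
  from assms obtain l where l: "germ f x (l x) (l x)" for x
    unfolding kink_def by (metis add.right_neutral)
  have D: "(f has_real_derivative l x) (at x)" for x
    using germ_has_derivative_iff[OF l] by blast
  have "(l has_real_derivative 0) (at x)" for x
  proof -
    from l[of x] obtain e where e: "e > 0"
      and fe: "\<And>h. 0 < h \<Longrightarrow> h < e \<Longrightarrow> f (x + h) = f x + l x * h \<and> f (x - h) = f x - l x * h"
      unfolding germ_def eventually_at_right_field by auto
    have f_near: "f y = l x * y + (f x - l x * x)" if "y \<in> {x - e<..<x + e}" for y
    proof -
      consider "y < x" | "y = x" | "x < y" by linarith
      then show ?thesis
        using fe[of "y - x"] fe[of "x - y"] that by cases (auto simp: algebra_simps)
    qed
    \<comment> \<open>The slope at a nearby point can only be that of the segment on which it lies.\<close>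
    have l_near: "l x = l y" if y: "y \<in> {x - e<..<x + e}" for y
    proof -
      have "((\<lambda>y. l x * y + (f x - l x * x)) has_real_derivative l x) (at y)"
        by (auto intro!: derivative_eq_intros)
      then have "(f has_real_derivative l x) (at y)"
        by (rule has_field_derivative_transform_within_open[OF _ _ y]) (simp, metis f_near)
      with D show ?thesis by (metis DERIV_unique)
    qed
    show ?thesis
    proof (rule has_field_derivative_transform_within_open)
      show "((\<lambda>_. l x) has_real_derivative 0) (at x)" by simp
      show "x \<in> {x - e<..<x + e}" using e by simp
    qed (simp, rule l_near)
  qed
  then have l0: "l x = l 0" for x by (intro DERIV_isconst_all) auto
  have "((\<lambda>x. f x - l 0 * x) has_real_derivative 0) (at x)" for x
    using D[of x] l0[of x] by (auto intro!: derivative_eq_intros)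
  then have "f x - l 0 * x = f 0 - l 0 * 0" for x
    using DERIV_isconst_all[of "\<lambda>x. f x - l 0 * x"] by blast
  then have "f x = l 0 * x + f 0" for x by (metis diff_eq_eq diff_zero add.commute mult_zero_right)
  then show ?thesis by blast
qed

section \<open>Broken lines as sums of ramps\<close>

type_synonym breaks = "(real \<times> rat) list"

text \<open>
  A piecewise linear function given by its leftmost linear piece \<open>m * x + c\<close> and the list of pairs
  \<open>(t, j)\<close> of a root \<open>t\<close> and the jump \<open>j\<close> of the slope there.
\<close>

definition broken_line :: "rat \<Rightarrow> real \<Rightarrow> breaks \<Rightarrow> real \<Rightarrow> real" where
  "broken_line m c bs x = of_rat m * x + c + (\<Sum>(t, j)\<leftarrow>bs. of_rat j * max 0 (x - t))"

text \<open>
  The slopes of the successive linear pieces, from left to right; this reading presupposes that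
  the breaks are sorted.
\<close>

fun pieces :: "rat \<Rightarrow> breaks \<Rightarrow> rat list" where
  "pieces m [] = [m]"
| "pieces m ((t, j) # bs) = m # pieces (m + j) bs"

lemma broken_line_before:
  "\<forall>(t, j)\<in>set bs. x \<le> t \<Longrightarrow> broken_line m c bs x = of_rat m * x + c"
  unfolding broken_line_def by (induction bs) auto

text \<open>
  To the right of the first break the function is the broken line with the remaining breaks whose
  leftmost piece is the second one. All recursions along the breaks rest on this identity.
\<close>

lemma broken_line_after:
  "t \<le> x \<Longrightarrow> broken_line m c ((t, j) # bs) x = broken_line (m + j) (c - of_rat j * t) bs x"
  unfolding broken_line_def by (simp add: of_rat_add algebra_simps)

lemma kink_broken_line:
  "kink (broken_line m c bs) x (\<Sum>(t, j)\<leftarrow>bs. if x = t then of_rat j else 0)"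
proof -
  have "kink (\<lambda>x. \<Sum>(t, j)\<leftarrow>bs. of_rat j * max 0 (x - t)) x (\<Sum>(t, j)\<leftarrow>bs. if x = t then of_rat j else 0)"
  proof (induction bs)
    case Nil
    show ?case using kink_affine[of 0 0 x] by simp
  next
    case (Cons b bs)
    from kink_add[OF kink_ramp Cons, of "of_rat (snd b)" "fst b"] show ?case
      by (simp add: case_prod_beta)
  qed
  from kink_add[OF kink_affine this] show ?thesis
    unfolding broken_line_def by simp
qed

text \<open>
  The bound \<open>L\<close> makes the induction work: the interval found for the remaining breaks has to lie
  to the right of the first break, where \<open>broken_line_after\<close> applies.
\<close>

lemma pieces_are_slopes_beyond:
  assumes "sorted_wrt (<) (map fst bs)" "\<forall>(t, j)\<in>set bs. L < t" "s \<in> set (pieces m bs)"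
  shows "\<exists>l u c'. L \<le> l \<and> l < u \<and> (\<forall>x\<in>{l<..<u}. broken_line m c bs x = of_rat s * x + c')"
  using assms
proof (induction m bs arbitrary: L c rule: pieces.induct)
  case (1 m)
  then show ?case
    by (intro exI[of _ L] exI[of _ "L + 1"] exI[of _ c]) (simp add: broken_line_def)
next
  case (2 m t j bs)
  from "2.prems"(3) consider "s = m" | "s \<in> set (pieces (m + j) bs)" by auto
  then show ?case
  proof cases
    case 1
    have "broken_line m c ((t, j) # bs) x = of_rat m * x + c" if "x \<in> {L<..<t}" for x
      using that "2.prems"(1) by (intro broken_line_before) force
    with 1 "2.prems"(2) show ?thesis
      by (intro exI[of _ L] exI[of _ t] exI[of _ c]) auto
  next
    case 2
    from "2.prems"(1) have "sorted_wrt (<) (map fst bs)" "\<forall>(t', j)\<in>set bs. t < t'" by auto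
    from "2.IH"[OF this 2, of "c - of_rat j * t"] obtain l u c' where
      "t \<le> l" "l < u" "\<forall>x\<in>{l<..<u}. broken_line (m + j) (c - of_rat j * t) bs x = of_rat s * x + c'"
      by blast
    with "2.prems"(2) show ?thesis
      by (intro exI[of _ l] exI[of _ u] exI[of _ c']) (auto simp: broken_line_after)
  qed
qed

lemma pieces_are_slopes:
  assumes "sorted_wrt (<) (map fst bs)"
  shows "real_of_rat ` set (pieces m bs) \<subseteq> slopes (broken_line m c bs)"
proof
  fix s assume "s \<in> real_of_rat ` set (pieces m bs)"
  then obtain s' where s': "s = of_rat s'" "s' \<in> set (pieces m bs)" by auto
  \<comment> \<open>Any point to the left of all breaks will do; \<open>0\<close> keeps the minimum defined for an empty list.\<close>
  define L where "L = Min (insert 0 (fst ` set bs)) - 1"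
  have "L < t" if "(t, j) \<in> set bs" for t j
  proof -
    have "Min (insert 0 (fst ` set bs)) \<le> t" using that by (intro Min_le) force+
    then show ?thesis unfolding L_def by linarith
  qed
  with pieces_are_slopes_beyond[OF assms _ s'(2), of L c] s'(1)
  show "s \<in> slopes (broken_line m c bs)" unfolding slopes_def by blast
qed

section \<open>Factoring a broken line into binomials\<close>

text \<open>
  For \<open>\<rho> > 0\<close> it fixes the half-line right of \<open>t\<close> and stretches the left one by \<open>\<rho>\<close> about \<open>t\<close>. Its
  first linear form is the identity, and which of the extrema is needed depends only on whether
  \<open>\<rho>\<close> exceeds \<open>1\<close>.
\<close>

definition inner_factor :: "real \<Rightarrow> rat \<Rightarrow> binomial" where
  "inner_factor t \<rho> = Binomial (if 1 < \<rho> then Minimum else Maximum) 1 0 \<rho> (t - of_rat \<rho> * t)"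

text \<open>
  The broken line with a single break, written as a binomial.
\<close>

definition outer_factor :: "real \<Rightarrow> rat \<Rightarrow> rat \<Rightarrow> real \<Rightarrow> binomial" where
  "outer_factor t j m c =
     Binomial (if j < 0 then Minimum else Maximum) m c (m + j) (c - of_rat j * t)"

text \<open>
  Each break except the last one splits off an innermost factor: replace \<open>f\<close> by the function that
  agrees with it to the right of the first root \<open>t\<close> and continues the second piece, of slope
  \<open>m + j\<close>, to the left. Precomposing it with the stretching by \<open>m / (m + j)\<close> about \<open>t\<close> gives back
  the slope \<open>m\<close> there.
\<close>

fun factors :: "rat \<Rightarrow> real \<Rightarrow> breaks \<Rightarrow> binomial list" where
  "factors m c [] = []"
| "factors m c [(t, j)] = [outer_factor t j m c]"
| "factors m c ((t, j) # b # bs) =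
     factors (m + j) (c - of_rat j * t) (b # bs) @ [inner_factor t (m / (m + j))]"

lemma length_factors [simp]: "length (factors m c bs) = length bs"
  by (induction m c bs rule: factors.induct) auto

lemma compose_append: "compose (As @ Bs) = compose As \<circ> compose Bs"
  unfolding compose_def by (induction As) (auto simp: fun_eq_iff)

text \<open>
  The difference of the two linear forms is \<open>(\<rho> - 1) * (x - t)\<close>, whose sign decides between them.
\<close>

lemma inner_factor_fun:
  "0 < \<rho> \<Longrightarrow> binomial_fun (inner_factor t \<rho>) x = (if t \<le> x then x else of_rat \<rho> * (x - t) + t)"
proof -
  have *: "0 < (r - 1) * (x - t) \<longleftrightarrow> (1 < r \<and> t < x \<or> r < 1 \<and> x < t)" for r :: real
    by (auto simp: zero_less_mult_iff)
  have **: "real_of_rat \<rho> * x + (t - real_of_rat \<rho> * t) - x = (real_of_rat \<rho> - 1) * (x - t)"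
    by (simp add: algebra_simps)
  have ***: "1 < \<rho> \<longleftrightarrow> 1 < real_of_rat \<rho>" by simp
  show ?thesis
    unfolding inner_factor_def
    using *[of "real_of_rat \<rho>"] ** unfolding ***
    by (auto simp: min_def max_def algebra_simps not_less) 
qed

lemma outer_factor_fun: "binomial_fun (outer_factor t j m c) x = broken_line m c [(t, j)] x"
proof -
  have *: "0 \<le> real_of_rat j * (x - t) \<longleftrightarrow> (0 \<le> j \<and> t \<le> x \<or> j \<le> 0 \<and> x \<le> t)"
    by (auto simp: zero_le_mult_iff)
  show ?thesis
    using * unfolding outer_factor_def broken_line_def
    by (auto simp: min_def max_def algebra_simps of_rat_add not_less)
qed

lemma pieces_not_Nil [simp]: "pieces m bs \<noteq> []"
  by (cases "(m, bs)" rule: pieces.cases) auto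

lemma hd_in_pieces: "m \<in> set (pieces m bs)" 
  by (cases "(m, bs)" rule: pieces.cases) auto

text \<open>
  If the slopes \<open>m\<close> and \<open>m + j\<close> on the two sides of a root have the same sign, the stretching by
  their ratio maps the half-line left of the root to itself and hence does not meet the later
  roots. The last slope occurs in no ratio, and so the condition leaves it out; in the concave
  case it may vanish.
\<close>

lemma compose_factors:
  assumes "bs \<noteq> []" "sorted_wrt (<) (map fst bs)"
    "(\<forall>s\<in>set (butlast (pieces m bs)). 0 < s) \<or> (\<forall>s\<in>set (butlast (pieces m bs)). s < 0)"
  shows "compose (factors m c bs) = broken_line m c bs"
  using assms
proof (induction m c bs rule: factors.induct)
  case (1 m c)
  then show ?case by simp
next
  case (2 m c t j)
  show ?case by (auto simp: compose_def outer_factor_fun fun_eq_iff)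
next
  case (3 m c t j b bs)
  obtain t' j' where b: "b = (t', j')" by (cases b)
  let ?B = "inner_factor t (m / (m + j))"
  from "3.prems"(3) b have pos: "0 < m / (m + j)"
    by (auto simp: zero_less_divide_iff)
  then have nz: "real_of_rat m + of_rat j \<noteq> 0" by (metis div_by_0 less_irrefl of_rat_eq_0_iff of_rat_add)
  have "compose (factors (m + j) (c - of_rat j * t) (b # bs)) =
      broken_line (m + j) (c - of_rat j * t) (b # bs)"
    using "3.prems" b by (intro "3.IH") auto
  then have "compose (factors m c ((t, j) # b # bs)) x =
      broken_line (m + j) (c - of_rat j * t) (b # bs) (binomial_fun ?B x)" for x
    by (simp add: compose_append) (simp add: compose_def)
  also have "\<dots> x = broken_line m c ((t, j) # b # bs) x" for x
  proof (cases "t \<le> x")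
    case True
    with pos show ?thesis by (simp add: inner_factor_fun broken_line_after)
  next
    case False
    let ?y = "binomial_fun ?B x"
    have y: "?y = of_rat m / (of_rat m + of_rat j) * (x - t) + t"
      using False inner_factor_fun[OF pos] by (simp add: of_rat_divide of_rat_add)
    \<comment> \<open>The stretched point stays to the left of \<open>t\<close>, where only the first piece is seen.\<close>
    have "?y \<le> t"
      using False pos inner_factor_fun[OF pos, of t x]
      by (simp add: mult_nonneg_nonpos)
    then have "\<forall>(t, j)\<in>set (b # bs). ?y \<le> t" using "3.prems"(2) by fastforce
    then have "broken_line (m + j) (c - of_rat j * t) (b # bs) ?y = of_rat (m + j) * ?y + (c - of_rat j * t)"
      by (rule broken_line_before)
    also have "\<dots> = of_rat m * x + c"
      using nz unfolding y by (simp add: of_rat_add field_simps)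
    also have "\<dots> = broken_line m c ((t, j) # b # bs) x"
      using False "3.prems"(2) by (intro broken_line_before[symmetric]) fastforce
    finally show ?thesis .
  qed
  finally show ?case by (simp add: fun_eq_iff)
qed

lemma monotone_factors:
  assumes "\<forall>(t, j)\<in>set bs. j \<noteq> 0"
    "(\<forall>s\<in>set (pieces m bs). 0 < s) \<or> (\<forall>s\<in>set (pieces m bs). s < 0)"
  shows "\<forall>B\<in>set (factors m c bs). monotone_rational_binomial B"
  using assms
proof (induction m c bs rule: factors.induct)
  case (3 m c t j b bs)
  have "m + j \<in> set (pieces (m + j) (b # bs))" by (rule hd_in_pieces)
  with 3 show ?case
    by (auto simp: inner_factor_def monotone_rational_binomial_def rational_binomial_def zero_less_divide_iff)
qed (auto simp: outer_factor_def monotone_rational_binomial_def rational_binomial_def)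

text \<open>
  For a concave function the slopes decrease, so that every ratio \<open>m / (m + j)\<close> exceeds \<open>1\<close> and
  all extrema are minima. The slope \<open>0\<close> can only be the last one, and the last slope enters only
  the outermost factor.
\<close>

lemma concave_factors:
  assumes "bs \<noteq> []" "\<forall>(t, j)\<in>set bs. j < 0" "\<forall>s\<in>set (pieces m bs). 0 \<le> s"
  shows "(\<forall>B\<in>set (tl (factors m c bs)). algebraic_binomial B) \<and>
    (algebraic_binomial (hd (factors m c bs)) \<or>
       0 \<in> set (pieces m bs) \<and> half_constant_binomial (hd (factors m c bs)))"
  using assms
proof (induction m c bs rule: factors.induct)
  case (2 m c t j)
  then show ?case
    by (auto simp: outer_factor_def algebraic_binomial_def rational_binomial_def half_constant_binomial_def)
next
  case (3 m c t j b bs)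
  obtain t' j' where b: "b = (t', j')" by (cases b)
  let ?Bs = "factors (m + j) (c - of_rat j * t) (b # bs)"
  have ne: "?Bs \<noteq> []" by (metis length_factors length_0_conv list.discI)
  have "0 \<le> m + j + j'" "j < 0" "j' < 0"
    using "3.prems" b hd_in_pieces[of "m + j + j'" bs] by auto
  then have "0 < m + j" "j < 0" by auto
  then have "1 < m / (m + j)" by simp
  then have "algebraic_binomial (inner_factor t (m / (m + j)))"
    by (auto simp: inner_factor_def algebraic_binomial_def rational_binomial_def)
  with 3 ne show ?case by auto
qed simp

text \<open>
  Each slope but the last one is larger than its successor, which is not negative.
\<close>

lemma concave_pieces_pos:
  assumes "\<forall>(t, j)\<in>set bs. j < 0" "\<forall>s\<in>set (pieces m bs). 0 \<le> s"
  shows "\<forall>s\<in>set (butlast (pieces m bs)). 0 < s"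
  using assms
proof (induction m bs rule: pieces.induct)
  case (2 m t j bs)
  with hd_in_pieces[of "m + j" bs] show ?case by auto
qed simp

section \<open>Finding the tropical roots from the linear forms\<close>

definition lower_envelope :: "linear_forms \<Rightarrow> real \<Rightarrow> real" where
  "lower_envelope p x = Min ((\<lambda>(b, a). of_rat b * x + a) ` set p)"

lemma lower_envelope_single: "lower_envelope [(b, a)] x = of_rat b * x + a"
  by (simp add: lower_envelope_def)

lemma lower_envelope_Cons:
  "p \<noteq> [] \<Longrightarrow> lower_envelope ((b, a) # p) x = min (of_rat b * x + a) (lower_envelope p x)"
  by (simp add: lower_envelope_def)

text \<open>
  The behaviour at a point of a minimum of linear forms: the value, the right and the left slope.
  The right slope is the smaller one.
\<close>

type_synonym local_form = "real \<times> rat \<times> rat"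

text \<open>
  The local form of \<open>min (b * y + a) g\<close> at a point \<open>x\<close>, where \<open>v = b * x + a\<close> and the last
  argument is the local form of \<open>g\<close>.
\<close>

fun add_form :: "real \<Rightarrow> rat \<Rightarrow> local_form \<Rightarrow> local_form" where
  "add_form v b (w, lo, hi) =
     (if v < w then (v, b, b) else if w < v then (w, lo, hi) else (v, min b lo, max b hi))"

text \<open>
  The minimum over no forms is not defined; the value for the empty list is a mere default.
\<close>

fun scan :: "linear_forms \<Rightarrow> real \<Rightarrow> local_form" where
  "scan [] x = (0, 0, 0)"
| "scan [(b, a)] x = (of_rat b * x + a, b, b)"
| "scan ((b, a) # fm # p) x = add_form (of_rat b * x + a) b (scan (fm # p) x)"

definition height :: "linear_forms \<Rightarrow> real \<Rightarrow> real" where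
  "height p x = fst (scan p x)"

definition right_slope :: "linear_forms \<Rightarrow> real \<Rightarrow> rat" where
  "right_slope p x = fst (snd (scan p x))"

definition left_slope :: "linear_forms \<Rightarrow> real \<Rightarrow> rat" where
  "left_slope p x = snd (snd (scan p x))"

lemma of_rat_max: "real_of_rat (max a b) = max (of_rat a) (of_rat b)"
  by (simp add: max_def of_rat_less_eq)

lemma of_rat_min: "real_of_rat (min a b) = min (of_rat a) (of_rat b)"
  by (simp add: min_def of_rat_less_eq)

text \<open>
  The slopes are attained by forms that are minimal at \<open>x\<close>; this is what locates the roots at
  crossings. It has to be part of the same induction, since a later form may replace the earlier
  ones.
\<close>

lemma scan_sound:
  assumes "p \<noteq> []" "scan p x = (v, lo, hi)"
  shows "v = lower_envelope p x" "germ (lower_envelope p) x (of_rat hi) (of_rat lo)" "lo \<le> hi"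
    "\<exists>a. (lo, a) \<in> set p \<and> of_rat lo * x + a = v" "\<exists>a. (hi, a) \<in> set p \<and> of_rat hi * x + a = v"
proof -
  have "v = lower_envelope p x \<and> germ (lower_envelope p) x (of_rat hi) (of_rat lo) \<and> lo \<le> hi \<and>
    (\<exists>a. (lo, a) \<in> set p \<and> of_rat lo * x + a = v) \<and> (\<exists>a. (hi, a) \<in> set p \<and> of_rat hi * x + a = v)"
    using assms
  proof (induction p x arbitrary: v lo hi rule: scan.induct)
    case (2 b a x)
    have "lower_envelope [(b, a)] = (\<lambda>x. of_rat b * x + a)"
      by (simp add: fun_eq_iff lower_envelope_single)
    with 2 show ?case by (auto simp: germ_affine)
  next
    case (3 b a fm p x)
    let ?p = "fm # p" and ?q = "(b, a) # fm # p" and ?v = "of_rat b * x + a"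
    obtain w l h where scan: "scan ?p x = (w, l, h)" by (cases "scan ?p x")
    have IH: "w = lower_envelope ?p x" "germ (lower_envelope ?p) x (of_rat h) (of_rat l)" "l \<le> h"
      "\<exists>a. (l, a) \<in> set ?p \<and> of_rat l * x + a = w" "\<exists>a. (h, a) \<in> set ?p \<and> of_rat h * x + a = w"
      using "3.IH"[OF list.distinct(2) scan] by blast+
    have env: "lower_envelope ?q = (\<lambda>x. min (of_rat b * x + a) (lower_envelope ?p x))"
      by (simp add: fun_eq_iff lower_envelope_Cons)
    note g = germ_affine[of "of_rat b" a x] IH(2)
    consider "?v < w" | "w < ?v" | "?v = w" by linarith
    then show ?case
    proof cases
      case 1
      with "3.prems" scan have "v = ?v" "lo = b" "hi = b" by auto
      then show ?thesis using 1 IH(1) germ_min_less[OF g] by (auto simp: env)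
    next
      case 2
      with "3.prems" scan have "v = w" "lo = l" "hi = h" by auto
      moreover have "germ (lower_envelope ?q) x (of_rat h) (of_rat l)"
        using 2 IH(1) germ_min_less[OF g(2,1)] by (simp add: env min.commute)
      moreover have "w = lower_envelope ?q x" using 2 IH(1) by (simp add: env)
      ultimately show ?thesis using IH(3-5) by auto
    next
      case 3
      with "3.prems" scan have eqs: "v = ?v" "lo = min b l" "hi = max b h" by auto
      moreover have "germ (lower_envelope ?q) x (of_rat (max b h)) (of_rat (min b l))"
        using 3 IH(1) germ_min_eq[OF g] by (simp add: env of_rat_max of_rat_min)
      moreover have "?v = lower_envelope ?q x" using 3 IH(1) by (simp add: env)
      moreover have "\<exists>a'. (min b l, a') \<in> set ?q \<and> of_rat (min b l) * x + a' = ?v"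
        using IH(4) 3 by (cases "b \<le> l") (auto simp: min_def)
      moreover have "\<exists>a'. (max b h, a') \<in> set ?q \<and> of_rat (max b h) * x + a' = ?v"
        using IH(5) 3 by (cases "b \<le> h") (auto simp: max_def)
      ultimately show ?thesis using IH(3) by auto
    qed
  qed simp
  then show "v = lower_envelope p x" "germ (lower_envelope p) x (of_rat hi) (of_rat lo)" "lo \<le> hi"
    "\<exists>a. (lo, a) \<in> set p \<and> of_rat lo * x + a = v" "\<exists>a. (hi, a) \<in> set p \<and> of_rat hi * x + a = v"
    by blast+
qed

lemma scan_eq: "scan p x = (height p x, right_slope p x, left_slope p x)"
  by (simp add: height_def right_slope_def left_slope_def)

lemma scan_facts:
  assumes "p \<noteq> []"
  shows height_eq: "height p x = lower_envelope p x"
    and germ_lower_envelope: "germ (lower_envelope p) x (of_rat (left_slope p x)) (of_rat (right_slope p x))"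
    and right_le_left_slope: "right_slope p x \<le> left_slope p x"
    and right_slope_attained: "\<exists>a. (right_slope p x, a) \<in> set p \<and> of_rat (right_slope p x) * x + a = height p x"
    and left_slope_attained: "\<exists>a. (left_slope p x, a) \<in> set p \<and> of_rat (left_slope p x) * x + a = height p x"
proof -
  note scan_sound[OF assms scan_eq]
  then show "height p x = lower_envelope p x"
    "germ (lower_envelope p) x (of_rat (left_slope p x)) (of_rat (right_slope p x))"
    "right_slope p x \<le> left_slope p x"
    "\<exists>a. (right_slope p x, a) \<in> set p \<and> of_rat (right_slope p x) * x + a = height p x"
    "\<exists>a. (left_slope p x, a) \<in> set p \<and> of_rat (left_slope p x) * x + a = height p x"
    by blast+
qed

text \<open>
  Jumps of the two minima may cancel, so that a common root of both need not be a root of the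
  difference.
\<close>

definition jump :: "linear_forms \<Rightarrow> linear_forms \<Rightarrow> real \<Rightarrow> rat" where
  "jump p q x = (right_slope p x - left_slope p x) - (right_slope q x - left_slope q x)"

text \<open>
  A number that is already present is not inserted again: a root at which several pairs of forms
  cross must be listed once.
\<close>

fun insert_sorted :: "real \<Rightarrow> real list \<Rightarrow> real list" where
  "insert_sorted x [] = [x]"
| "insert_sorted x (y # ys) = (if x < y then x # y # ys else if y < x then y # insert_sorted x ys else y # ys)"

lemma set_insert_sorted [simp]: "set (insert_sorted x ys) = insert x (set ys)"
  by (induction ys) auto

lemma sorted_insert_sorted: "sorted_wrt (<) ys \<Longrightarrow> sorted_wrt (<) (insert_sorted x ys)"
  by (induction ys) auto

fun crossings_with :: "rat \<times> real \<Rightarrow> linear_forms \<Rightarrow> real list \<Rightarrow> real list" where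
  "crossings_with fm [] xs = xs"
| "crossings_with (b, a) ((b', a') # p) xs = crossings_with (b, a) p
     (if b = b' then xs else insert_sorted ((a' - a) / (of_rat b - of_rat b')) xs)"

fun crossings :: "linear_forms \<Rightarrow> linear_forms \<Rightarrow> real list \<Rightarrow> real list" where
  "crossings [] p xs = xs"
| "crossings (fm # ps) p xs = crossings ps p (crossings_with fm p xs)"

lemma sorted_crossings_with: "sorted_wrt (<) xs \<Longrightarrow> sorted_wrt (<) (crossings_with fm p xs)"
  by (induction fm p xs rule: crossings_with.induct) (auto simp: sorted_insert_sorted)

lemma sorted_crossings: "sorted_wrt (<) xs \<Longrightarrow> sorted_wrt (<) (crossings ps p xs)"
  by (induction ps p xs rule: crossings.induct) (auto simp: sorted_crossings_with)

lemma crossings_with_extends: "set xs \<subseteq> set (crossings_with fm p xs)"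
  by (induction fm p xs rule: crossings_with.induct) (auto split: if_splits)

lemma crossings_extends: "set xs \<subseteq> set (crossings ps p xs)"
  by (induction ps p xs rule: crossings.induct) (use crossings_with_extends in \<open>simp, fastforce\<close>)

lemma crossing_in_crossings_with:
  assumes "(b', a') \<in> set p" "b \<noteq> b'" "of_rat b * x + a = of_rat b' * x + a'"
  shows "x \<in> set (crossings_with (b, a) p xs)"
  using assms
proof (induction p arbitrary: xs)
  case (Cons fm p)
  show ?case
  proof (cases "fm = (b', a')")
    case True
    have "x = (a' - a) / (of_rat b - of_rat b')" using Cons.prems(2,3) by (simp add: field_simps)
    with True Cons.prems(2) crossings_with_extends show ?thesis by fastforce
  next
    case False
    with Cons show ?thesis by (cases fm) auto
  qed
qed simp

lemma crossing_in_crossings: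
  assumes "(b, a) \<in> set ps" "(b', a') \<in> set p" "b \<noteq> b'" "of_rat b * x + a = of_rat b' * x + a'"
  shows "x \<in> set (crossings ps p xs)"
  using assms
proof (induction ps arbitrary: xs)
  case (Cons fm ps)
  then show ?case
    using crossing_in_crossings_with[OF assms(2-4)] crossings_extends by (cases "fm = (b, a)") fastforce+
qed simp

text \<open>
  Where the left and right slopes differ, two forms of different slope attain the minimum, and
  they cross there.
\<close>

lemma change_of_slope_in_crossings:
  assumes "p \<noteq> []" "right_slope p x \<noteq> left_slope p x"
  shows "x \<in> set (crossings p p xs)"
proof -
  from right_slope_attained[OF assms(1)] left_slope_attained[OF assms(1)] obtain a a' where
    "(right_slope p x, a) \<in> set p" "(left_slope p x, a') \<in> set p"
    "of_rat (right_slope p x) * x + a = of_rat (left_slope p x) * x + a'"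
    by metis
  with assms(2) show ?thesis by (intro crossing_in_crossings)
qed

text \<open>
  The crossings are only candidates for roots: two forms may cross above the minimum.
\<close>

definition breaks_at :: "linear_forms \<Rightarrow> linear_forms \<Rightarrow> real list \<Rightarrow> breaks" where
  "breaks_at p q xs = map (\<lambda>x. (x, jump p q x)) (filter (\<lambda>x. jump p q x \<noteq> 0) xs)"

definition breaks_of :: "linear_forms \<Rightarrow> linear_forms \<Rightarrow> breaks" where
  "breaks_of p q = breaks_at p q (crossings q q (crossings p p []))"

lemma sorted_breaks_of: "sorted_wrt (<) (map fst (breaks_of p q))"
proof -
  have "sorted_wrt (<) (crossings q q (crossings p p []))"
    by (intro sorted_crossings) simp
  then show ?thesis
    unfolding breaks_of_def breaks_at_def by (simp add: comp_def sorted_wrt_filter)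
qed

lemma set_breaks_of:
  assumes "p \<noteq> []" "q \<noteq> []"
  shows "set (breaks_of p q) = {(x, jump p q x) | x. jump p q x \<noteq> 0}"
proof -
  have "x \<in> set (crossings q q (crossings p p []))" if "jump p q x \<noteq> 0" for x
  proof -
    from that have "right_slope p x \<noteq> left_slope p x \<or> right_slope q x \<noteq> left_slope q x"
      by (auto simp: jump_def)
    then show ?thesis
      using change_of_slope_in_crossings assms crossings_extends by blast
  qed
  then show ?thesis unfolding breaks_of_def breaks_at_def by auto
qed

lemma germ_difference:
  assumes "p \<noteq> []" "q \<noteq> []"
  shows "germ (\<lambda>x. lower_envelope p x - lower_envelope q x) x
    (of_rat (left_slope p x - left_slope q x)) (of_rat (right_slope p x - right_slope q x))"
  using germ_diff[OF germ_lower_envelope[OF assms(1)] germ_lower_envelope[OF assms(2)]]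
  by (simp add: of_rat_diff)

lemma tropical_roots_eq:
  assumes "p \<noteq> []" "q \<noteq> []"
  shows "tropical_roots (\<lambda>x. lower_envelope p x - lower_envelope q x) = fst ` set (breaks_of p q)"
proof -
  have "x \<in> tropical_roots (\<lambda>x. lower_envelope p x - lower_envelope q x) \<longleftrightarrow> jump p q x \<noteq> 0" for x
    by (auto simp: germ_imp_root_iff[OF germ_difference[OF assms]] jump_def algebra_simps)
  then show ?thesis using set_breaks_of[OF assms] by force
qed

lemma card_tropical_roots:
  assumes "p \<noteq> []" "q \<noteq> []"
  shows "card (tropical_roots (\<lambda>x. lower_envelope p x - lower_envelope q x)) = length (breaks_of p q)"
proof -
  have "distinct (map fst (breaks_of p q))"
    using sorted_breaks_of strict_sorted_iff by blast
  then show ?thesis using tropical_roots_eq[OF assms] distinct_card by fastforce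
qed

text \<open>
  The leftmost linear piece is read off at the first root, where it ends: its slope is the left
  slope of the function and its value there is the value of the function.
\<close>

definition first_slope :: "linear_forms \<Rightarrow> linear_forms \<Rightarrow> breaks \<Rightarrow> rat" where
  "first_slope p q bs = left_slope p (fst (hd bs)) - left_slope q (fst (hd bs))"

definition first_const :: "linear_forms \<Rightarrow> linear_forms \<Rightarrow> breaks \<Rightarrow> real" where
  "first_const p q bs = (height p (fst (hd bs)) - height q (fst (hd bs))) -
     of_rat (first_slope p q bs) * fst (hd bs)"

text \<open>
  The total kink at \<open>x\<close> of a broken line whose jumps are the values of a function \<open>g\<close>, with every
  point of the support listed exactly once.
\<close>

lemma sum_breaks:
  assumes "distinct (map fst bs)" "\<And>t j. (t, j) \<in> set bs \<Longrightarrow> j = g t"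
    "g x \<noteq> 0 \<Longrightarrow> x \<in> fst ` set bs"
  shows "(\<Sum>(t, j)\<leftarrow>bs. if x = t then of_rat j else 0) = real_of_rat (g x)"
proof -
  have "(\<Sum>(t, j)\<leftarrow>bs. if x = t then real_of_rat j else 0) = (\<Sum>t\<leftarrow>map fst bs. if x = t then real_of_rat (g x) else 0)"
    using assms(2) by (auto intro!: arg_cong[where f = sum_list])
  also have "\<dots> = (\<Sum>t\<in>fst ` set bs. if x = t then real_of_rat (g x) else 0)"
    using assms(1) by (subst sum_list_distinct_conv_sum_set) auto
  also have "\<dots> = real_of_rat (g x)" using assms(3) by (auto simp: sum.delta)
  finally show ?thesis .
qed

text \<open>
  Both sides have the same jumps, so that they differ by an affine function. On a short interval
  ending at the first root both sides have the same value at the end and the same slope; so the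
  affine function vanishes.
\<close>

lemma difference_eq_broken_line:
  assumes "p \<noteq> []" "q \<noteq> []" and ne: "breaks_of p q \<noteq> []"
  defines "bs \<equiv> breaks_of p q"
  shows "(\<lambda>x. lower_envelope p x - lower_envelope q x) =
    broken_line (first_slope p q bs) (first_const p q bs) bs"
proof -
  define f where "f = (\<lambda>x. lower_envelope p x - lower_envelope q x)"
  define m where "m = first_slope p q bs"
  define c where "c = first_const p q bs"
  define t where "t = fst (hd bs)"
  have "distinct (map fst bs)" using sorted_breaks_of strict_sorted_iff unfolding bs_def by blast
  moreover have "j = jump p q t" if "(t, j) \<in> set bs" for t j
    using that set_breaks_of[OF assms(1,2)] by (auto simp: bs_def)
  moreover have "x \<in> fst ` set bs" if "jump p q x \<noteq> 0" for x
    using that set_breaks_of[OF assms(1,2)] by (force simp: bs_def)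
  ultimately have sum: "(\<Sum>(t, j)\<leftarrow>bs. if x = t then of_rat j else 0) = real_of_rat (jump p q x)" for x
    by (rule sum_breaks)
  have "kink f x (of_rat (jump p q x))" for x
    using germ_imp_kink[OF germ_difference[OF assms(1,2)], of x]
    by (simp add: f_def jump_def algebra_simps of_rat_diff of_rat_add)
  from kink_diff[OF this kink_broken_line[of m c bs]]
  have "kink (\<lambda>x. f x - broken_line m c bs x) x 0" for x by (simp add: sum)
  then obtain b a where affine: "f x - broken_line m c bs x = b * x + a" for x
    using kink_free_imp_affine by metis
  have "\<forall>(t', j)\<in>set bs. t \<le> t'"
    using sorted_breaks_of[of p q] ne unfolding t_def bs_def[symmetric] by (cases bs) force+
  then have line: "broken_line m c bs x = of_rat m * x + c" if "x \<le> t" for x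
    using that by (intro broken_line_before) fastforce
  have at: "f t = of_rat m * t + c"
    unfolding f_def c_def m_def first_const_def t_def
    by (simp add: height_eq[OF assms(1)] height_eq[OF assms(2)])
  have "germ f t (of_rat m) (of_rat (right_slope p t - right_slope q t))"
    using germ_difference[OF assms(1,2)] unfolding f_def m_def first_slope_def t_def .
  then have "\<forall>\<^sub>F h in at_right 0. f (t - h) = f t - of_rat m * h"
    unfolding germ_def by eventually_elim simp
  then obtain e where e: "e > 0" "\<And>h. 0 < h \<Longrightarrow> h < e \<Longrightarrow> f (t - h) = f t - of_rat m * h"
    unfolding eventually_at_right_field by auto
  \<comment> \<open>A second point of agreement, besides \<open>t\<close>, for the affine difference.\<close>
  have "f (t - e / 2) = of_rat m * (t - e / 2) + c"
    using e(2)[of "e / 2"] e(1) at by (simp add: algebra_simps)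
  with affine[of "t - e / 2"] line[of "t - e / 2"] e(1) have "b * (t - e / 2) + a = 0" by simp
  moreover from affine[of t] line[of t] at have ta: "b * t + a = 0" by simp
  ultimately have "b * (e / 2) = 0" by (simp only: right_diff_distrib)
  with e(1) have "b = 0" by simp
  with ta have "a = 0" by simp
  with \<open>b = 0\<close> affine show ?thesis unfolding f_def m_def c_def by (simp add: fun_eq_iff)
qed

section \<open>The decomposition of a tropical rational function\<close>

definition decomposition :: "linear_forms \<Rightarrow> linear_forms \<Rightarrow> binomial list" where
  "decomposition p q = (let bs = breaks_of p q in factors (first_slope p q bs) (first_const p q bs) bs)"

lemma tropical_algebraic_iff:
  "tropical_algebraic p f \<longleftrightarrow> p \<noteq> [] \<and> (\<forall>(b, a)\<in>set p. 0 \<le> b) \<and> f = lower_envelope p"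
  by (auto simp: tropical_algebraic_def lower_envelope_def fun_eq_iff)

text \<open>
  Monotonicity of the minimum bounds every slope from below, without an analysis of which linear
  forms occur as pieces.
\<close>

lemma slopes_nonneg:
  assumes "tropical_algebraic p f" "s \<in> slopes f"
  shows "0 \<le> s"
proof -
  have p: "p \<noteq> []" "\<forall>(b, a)\<in>set p. 0 \<le> b" and f: "f = lower_envelope p"
    using assms(1) by (auto simp: tropical_algebraic_iff)
  from assms(2) obtain l u c where lu: "l < u" "\<And>x. x \<in> {l<..<u} \<Longrightarrow> f x = s * x + c"
    unfolding slopes_def by blast
  have mono: "f x \<le> f y" if "x \<le> y" for x y
    unfolding f lower_envelope_def
  proof (subst Min_ge_iff)
    show "\<forall>z\<in>(\<lambda>(b, a). real_of_rat b * y + a) ` set p. Min ((\<lambda>(b, a). real_of_rat b * x + a) ` set p) \<le> z"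
    proof safe
      fix b a assume ba: "(b, a) \<in> set p"
      then have "Min ((\<lambda>(b, a). real_of_rat b * x + a) ` set p) \<le> real_of_rat b * x + a"
        by (intro Min_le) force+
      also have "\<dots> \<le> real_of_rat b * y + a"
        using ba p(2) that by (auto intro!: mult_left_mono)
      finally show "Min ((\<lambda>(b, a). real_of_rat b * x + a) ` set p) \<le> real_of_rat b * y + a" .
    qed
  qed (use p(1) in auto)
  define x y where "x = l + (u - l) / 3" and "y = l + (u - l) / 3 * 2"
  have "x < y" "x \<in> {l<..<u}" "y \<in> {l<..<u}" using lu(1) by (simp_all add: x_def y_def field_simps)
  with mono[of x y] lu(2)[of x] lu(2)[of y] have "s * x \<le> s * y" by simp
  with \<open>x < y\<close> show ?thesis by (simp add: mult_le_cancel_left)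
qed

lemma decomposition_correct:
  assumes "p \<noteq> []" "q \<noteq> []" and f: "f = (\<lambda>x. lower_envelope p x - lower_envelope q x)"
    and k: "1 \<le> card (tropical_roots f)"
  shows length_decomposition: "length (decomposition p q) = card (tropical_roots f)"
    and slopes_decomposition: "real_of_rat ` set (pieces (first_slope p q (breaks_of p q)) (breaks_of p q)) \<subseteq> slopes f"
    and compose_decomposition:
      "(\<forall>s\<in>set (butlast (pieces (first_slope p q (breaks_of p q)) (breaks_of p q))). 0 < s) \<or>
       (\<forall>s\<in>set (butlast (pieces (first_slope p q (breaks_of p q)) (breaks_of p q))). s < 0) \<Longrightarrow>
       compose (decomposition p q) = f"
proof -
  let ?bs = "breaks_of p q"
  have card: "card (tropical_roots f) = length ?bs" unfolding f by (rule card_tropical_roots[OF assms(1,2)])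
  with k have ne: "?bs \<noteq> []" by auto
  note line = difference_eq_broken_line[OF assms(1,2) ne]
  show "length (decomposition p q) = card (tropical_roots f)" using card by (simp add: decomposition_def Let_def)
  show "real_of_rat ` set (pieces (first_slope p q ?bs) ?bs) \<subseteq> slopes f"
    unfolding f line by (rule pieces_are_slopes[OF sorted_breaks_of])
  show "compose (decomposition p q) = f"
    if "(\<forall>s\<in>set (butlast (pieces (first_slope p q ?bs) ?bs)). 0 < s) \<or>
       (\<forall>s\<in>set (butlast (pieces (first_slope p q ?bs) ?bs)). s < 0)"
    unfolding f line decomposition_def Let_def using compose_factors[OF ne sorted_breaks_of that] .
qed

section \<open>Evaluation as rewriting\<close>

text \<open>
  The evaluation rules, restated as equivalences that the simplifier can use to run a program
  symbolically. Since evaluation is deterministic, equivalences with \<open>v = \<dots>\<close> on the right-hand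
  side also specify the functions of the program below; they serve as rewrite rules
  wherever the function is called.
\<close>

lemma evaluates_Var: "i < length env \<Longrightarrow> evaluates P env (Var i) v \<longleftrightarrow> v = env ! i"
  by (auto intro: evaluates.Var elim: evaluates_elims(1))

lemma evaluates_Const: "evaluates P env (Const c) v \<longleftrightarrow> v = Num (of_rat c)"
  by (auto intro: evaluates.Const elim: evaluates_elims(2))

lemma evaluates_Empty: "evaluates P env Empty v \<longleftrightarrow> v = Null"
  by (auto intro: evaluates.Empty elim: evaluates_elims(3))

lemma evaluates_MkPair:
  "evaluates P env (MkPair s t) v \<longleftrightarrow> (\<exists>a b. v = Cell a b \<and> evaluates P env s a \<and> evaluates P env t b)"
  by (auto intro: evaluates.MkPair elim: evaluates_elims(4))

lemma evaluates_First: "evaluates P env (First t) v \<longleftrightarrow> (\<exists>w. evaluates P env t (Cell v w))"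
  by (auto intro: evaluates.First elim: evaluates_elims(5))

lemma evaluates_Second: "evaluates P env (Second t) w \<longleftrightarrow> (\<exists>v. evaluates P env t (Cell v w))"
  by (auto intro: evaluates.Second elim: evaluates_elims(6))

lemma evaluates_Arith:
  "evaluates P env (Arith op s t) v \<longleftrightarrow>
     (\<exists>x y. v = Num (arith_fun op x y) \<and> evaluates P env s (Num x) \<and> evaluates P env t (Num y) \<and>
            (op = Div \<longrightarrow> y \<noteq> 0))"
  by (auto intro: evaluates.Arith elim!: evaluates_elims(7))

lemma evaluates_IfLess:
  "evaluates P env (IfLess s t u u') v \<longleftrightarrow>
     (\<exists>x y. evaluates P env s (Num x) \<and> evaluates P env t (Num y) \<and>
            (if x < y then evaluates P env u v else evaluates P env u' v))"
  by (auto intro: evaluates.IfLess_true evaluates.IfLess_false elim!: evaluates_elims(8) split: if_splits)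

lemma evaluates_IfPair:
  "evaluates P env (IfPair s u u') v \<longleftrightarrow>
     (\<exists>w. evaluates P env s w \<and>
          (case w of Cell _ _ \<Rightarrow> evaluates P env u v | _ \<Rightarrow> evaluates P env u' v))"
  (is "?L \<longleftrightarrow> ?R")
proof
  assume ?L
  then show ?R
  proof (rule evaluates_elims(9))
    fix w w' assume "evaluates P env s (Cell w w')" "evaluates P env u v"
    then show ?R by force
  next
    fix w assume "evaluates P env s w" "\<forall>w1 w2. w \<noteq> Cell w1 w2" "evaluates P env u' v"
    then show ?R by (intro exI[of _ w]) (cases w; simp)
  qed
next
  assume ?R
  then obtain w where "evaluates P env s w"
    "case w of Cell _ _ \<Rightarrow> evaluates P env u v | _ \<Rightarrow> evaluates P env u' v"
    by blast
  then show ?L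
    by (cases w) (auto intro: evaluates.IfPair_true evaluates.IfPair_false)
qed

lemma evaluates_Call:
  "i < length P \<Longrightarrow> evaluates P env (Call i ts) v \<longleftrightarrow>
     (\<exists>vs. list_all2 (evaluates P env) ts vs \<and> evaluates P vs (P ! i) v)"
  by (auto intro: evaluates.Call elim: evaluates_elims(10))

lemmas evaluates_simps = evaluates_Var evaluates_Const evaluates_Empty evaluates_MkPair evaluates_First
  evaluates_Second evaluates_Arith evaluates_IfLess evaluates_IfPair evaluates_Call list_all2_Cons1 Let_def

section \<open>The program\<close>

text \<open>
  The index of a function is its position in the list \<open>program\<close> below, where the entry point is at
  \<open>0\<close>.
\<close>

abbreviation "insert_call x xs \<equiv> Call 1 [x, xs]"
abbreviation "crossings_with_call fm p xs \<equiv> Call 2 [fm, p, xs]"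
abbreviation "crossings_call ps p xs \<equiv> Call 3 [ps, p, xs]"
abbreviation "add_form_call v b s \<equiv> Call 4 [v, b, s]"
abbreviation "scan_call p x \<equiv> Call 5 [p, x]"
abbreviation "jump_call p q x \<equiv> Call 6 [p, q, x]"
abbreviation "add_break_call x j bs \<equiv> Call 7 [x, j, bs]"
abbreviation "breaks_call p q xs \<equiv> Call 8 [p, q, xs]"
abbreviation "inner_call t r \<equiv> Call 9 [t, r]"
abbreviation "outer_call t j m c \<equiv> Call 10 [t, j, m, c]"
abbreviation "factors_call m c bs Bs \<equiv> Call 11 [m, c, bs, Bs]"
abbreviation "start_call p q bs \<equiv> Call 12 [p, q, bs]"

abbreviation (input) "height_of s \<equiv> First s"
abbreviation (input) "right_slope_of s \<equiv> First (Second s)"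
abbreviation (input) "left_slope_of s \<equiv> Second (Second s)"

definition main_body :: tm where
  "main_body = (let p = First (Var 0); q = Second (Var 0) in
     start_call p q (breaks_call p q (crossings_call q q (crossings_call p p Empty))))"

definition insert_body :: tm where
  "insert_body = (let x = Var 0; ys = Var 1 in
     IfPair ys
       (IfLess x (First ys) (MkPair x ys)
         (IfLess (First ys) x (MkPair (First ys) (insert_call x (Second ys))) ys))
       (MkPair x Empty))"

text \<open>
  Since \<open><\<close> is the only test, two slopes are found to differ by trying both orders.
\<close>

definition crossings_with_body :: tm where
  "crossings_with_body = (let fm = Var 0; p = Var 1; xs = Var 2;
       b = First fm; a = Second fm; b' = First (First p); a' = Second (First p);
       insertion = insert_call (Arith Div (Arith Sub a' a) (Arith Sub b b')) xs in
     IfPair p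
       (crossings_with_call fm (Second p) (IfLess b b' insertion (IfLess b' b insertion xs)))
       xs)"

definition crossings_body :: tm where
  "crossings_body = (let ps = Var 0; p = Var 1; xs = Var 2 in
     IfPair ps (crossings_call (Second ps) p (crossings_with_call (First ps) p xs)) xs)"

definition add_form_body :: tm where
  "add_form_body = (let v = Var 0; b = Var 1; s = Var 2;
       w = height_of s; lo = right_slope_of s; hi = left_slope_of s in
     IfLess v w (MkPair v (MkPair b b))
       (IfLess w v s
         (MkPair v (MkPair (IfLess b lo b lo) (IfLess hi b b hi)))))"

definition scan_body :: tm where
  "scan_body = (let p = Var 0; x = Var 1; b = First (First p); a = Second (First p);
       v = Arith Add (Arith Mul b x) a in
     IfPair (Second p) (add_form_call v b (scan_call (Second p) x)) (MkPair v (MkPair b b)))"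

definition jump_body :: tm where
  "jump_body = (let p = Var 0; q = Var 1; x = Var 2; s = scan_call p x; s' = scan_call q x in
     Arith Sub (Arith Sub (right_slope_of s) (left_slope_of s))
       (Arith Sub (right_slope_of s') (left_slope_of s')))"

definition add_break_body :: tm where
  "add_break_body = (let x = Var 0; j = Var 1; bs = Var 2; b = MkPair (MkPair x j) bs in
     IfLess j (Const 0) b (IfLess (Const 0) j b bs))"

definition breaks_body :: tm where
  "breaks_body = (let p = Var 0; q = Var 1; xs = Var 2 in
     IfPair xs
       (add_break_call (First xs) (jump_call p q (First xs)) (breaks_call p q (Second xs)))
       Empty)"

definition inner_body :: tm where
  "inner_body = (let t = Var 0; r = Var 1 in
     MkPair (IfLess (Const 1) r (Const 0) (Const 1)) (MkPair (Const 1) (MkPair (Const 0)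
       (MkPair r (MkPair (Arith Sub t (Arith Mul r t)) Empty)))))"

definition outer_body :: tm where
  "outer_body = (let t = Var 0; j = Var 1; m = Var 2; c = Var 3 in
     MkPair (IfLess j (Const 0) (Const 0) (Const 1)) (MkPair m (MkPair c
       (MkPair (Arith Add m j) (MkPair (Arith Sub c (Arith Mul j t)) Empty)))))"

text \<open>
  Factors split off earlier stand further right in the composition. They are collected in the
  argument \<open>Bs\<close>, which saves appending to a list.
\<close>

definition factors_body :: tm where
  "factors_body = (let m = Var 0; c = Var 1; bs = Var 2; Bs = Var 3;
       t = First (First bs); j = Second (First bs); m' = Arith Add m j in
     IfPair (Second bs)
       (factors_call m' (Arith Sub c (Arith Mul j t)) (Second bs)
         (MkPair (inner_call t (Arith Div m m')) Bs))
       (MkPair (outer_call t j m c) Bs))"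

definition start_body :: tm where
  "start_body = (let p = Var 0; q = Var 1; bs = Var 2; t = First (First bs);
       s = scan_call p t; s' = scan_call q t; m = Arith Sub (left_slope_of s) (left_slope_of s') in
     factors_call m (Arith Sub (Arith Sub (height_of s) (height_of s')) (Arith Mul m t)) bs Empty)"

definition program :: "tm list" where
  "program = [main_body, insert_body, crossings_with_body, crossings_body, add_form_body, scan_body,
     jump_body, add_break_body, breaks_body, inner_body, outer_body, factors_body, start_body]"

lemma length_program [simp]: "length program = 13"
  by (simp add: program_def)

lemma program_nth [simp]:
  "program ! 0 = main_body" "program ! Suc 0 = insert_body" "program ! 2 = crossings_with_body"
  "program ! 3 = crossings_body" "program ! 4 = add_form_body" "program ! 5 = scan_body"
  "program ! 6 = jump_body" "program ! 7 = add_break_body" "program ! 8 = breaks_body"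
  "program ! 9 = inner_body" "program ! 10 = outer_body" "program ! 11 = factors_body"
  "program ! 12 = start_body"
  by (simp_all add: program_def)

section \<open>Correctness of the program\<close>

definition numbers_val :: "real list \<Rightarrow> val" where
  "numbers_val xs = list_val (map Num xs)"

definition breaks_val :: "breaks \<Rightarrow> val" where
  "breaks_val bs = list_val (map (\<lambda>(t, j). Cell (Num t) (Num (of_rat j))) bs)"

fun local_form_val :: "local_form \<Rightarrow> val" where
  "local_form_val (v, lo, hi) = Cell (Num v) (Cell (Num (of_rat lo)) (Num (of_rat hi)))"

lemma val_simps [simp]:
  "numbers_val [] = Null" "numbers_val (x # xs) = Cell (Num x) (numbers_val xs)"
  "breaks_val [] = Null" "breaks_val ((t, j) # bs) = Cell (Cell (Num t) (Num (of_rat j))) (breaks_val bs)"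
  "forms_val [] = Null" "forms_val ((b, a) # p) = Cell (Cell (Num (of_rat b)) (Num a)) (forms_val p)"
  "output_val [] = Null" "output_val (B # Bs) = Cell (binomial_val B) (output_val Bs)"
  by (simp_all add: numbers_val_def breaks_val_def forms_val_def output_val_def)

lemma evaluates_insert:
  "evaluates program [Num x, numbers_val ys] insert_body v \<longleftrightarrow> v = numbers_val (insert_sorted x ys)"
proof (induction ys arbitrary: v)
  case Nil
  show ?case by (subst insert_body_def) (simp add: evaluates_simps)
next
  case (Cons y ys)
  then show ?case by (subst insert_body_def) (simp add: evaluates_simps)
qed

lemma evaluates_crossings_with:
  "evaluates program [Cell (Num (of_rat b)) (Num a), forms_val p, numbers_val xs] crossings_with_body v
     \<longleftrightarrow> v = numbers_val (crossings_with (b, a) p xs)"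
proof (induction p arbitrary: xs v)
  case Nil
  show ?case by (subst crossings_with_body_def) (simp add: evaluates_simps)
next
  case (Cons fm p)
  then show ?case
    by (cases fm, subst crossings_with_body_def)
      (auto simp: evaluates_simps evaluates_insert of_rat_less)
qed

lemma evaluates_crossings:
  "evaluates program [forms_val ps, forms_val p, numbers_val xs] crossings_body v
     \<longleftrightarrow> v = numbers_val (crossings ps p xs)"
proof (induction ps arbitrary: xs v)
  case Nil
  show ?case by (subst crossings_body_def) (simp add: evaluates_simps)
next
  case (Cons fm ps)
  then show ?case
    by (cases fm, subst crossings_body_def) (simp add: evaluates_simps evaluates_crossings_with)
qed

lemma evaluates_add_form:
  "evaluates program [Num v, Num (of_rat b), local_form_val s] add_form_body w
     \<longleftrightarrow> w = local_form_val (add_form v b s)"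
  by (cases s, subst add_form_body_def)
    (auto simp: evaluates_simps of_rat_less min_def max_def)

lemma evaluates_scan:
  assumes "p \<noteq> []"
  shows "evaluates program [forms_val p, Num x] scan_body v \<longleftrightarrow> v = local_form_val (scan p x)"
  using assms
proof (induction p x arbitrary: v rule: scan.induct)
  case (2 b a x)
  show ?case by (subst scan_body_def) (simp add: evaluates_simps)
next
  case (3 b a fm p x)
  from "3.IH" show ?case
    by (cases fm, subst scan_body_def) (simp add: evaluates_simps evaluates_add_form)
qed simp

lemma evaluates_jump:
  assumes "p \<noteq> []" "q \<noteq> []"
  shows "evaluates program [forms_val p, forms_val q, Num x] jump_body v \<longleftrightarrow> v = Num (of_rat (jump p q x))"
  by (subst jump_body_def)
    (simp add: evaluates_simps evaluates_scan assms scan_eq jump_def of_rat_diff)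

lemma evaluates_add_break:
  "evaluates program [Num x, Num (of_rat j), breaks_val bs] add_break_body v
     \<longleftrightarrow> v = breaks_val (if j = 0 then bs else (x, j) # bs)"
  by (subst add_break_body_def) (auto simp: evaluates_simps)

lemma evaluates_breaks:
  assumes "p \<noteq> []" "q \<noteq> []"
  shows "evaluates program [forms_val p, forms_val q, numbers_val xs] breaks_body v
     \<longleftrightarrow> v = breaks_val (breaks_at p q xs)"
proof (induction xs arbitrary: v)
  case Nil
  show ?case by (subst breaks_body_def) (simp add: evaluates_simps breaks_at_def)
next
  case (Cons x xs)
  then show ?case
    by (subst breaks_body_def)
      (simp add: evaluates_simps evaluates_jump[OF assms] evaluates_add_break breaks_at_def)
qed

lemma evaluates_inner:
  "evaluates program [Num t, Num (of_rat r)] inner_body v \<longleftrightarrow> v = binomial_val (inner_factor t r)"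
  by (subst inner_body_def) (auto simp: evaluates_simps inner_factor_def)

lemma evaluates_outer:
  "evaluates program [Num t, Num (of_rat j), Num (of_rat m), Num c] outer_body v
     \<longleftrightarrow> v = binomial_val (outer_factor t j m c)"
  by (subst outer_body_def) (auto simp: evaluates_simps outer_factor_def of_rat_add)

text \<open>
  The divisors in the ratios are the slopes strictly between the first and the last one. They are
  among those that the second hypothesis makes nonzero, and so the computation has a result.
\<close>

lemma evaluates_factors:
  assumes "bs \<noteq> []" "0 \<notin> set (butlast (pieces m bs))"
  shows "evaluates program [Num (of_rat m), Num c, breaks_val bs, output_val Bs] factors_body v
     \<longleftrightarrow> v = output_val (factors m c bs @ Bs)"
  using assms
proof (induction m c bs arbitrary: Bs v rule: factors.induct)
  case (2 m c t j)
  show ?case by (subst factors_body_def) (simp add: evaluates_simps evaluates_outer)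
next
  case (3 m c t j b bs)
  obtain t' j' where b: "b = (t', j')" by (cases b)
  from "3.prems" b have nz: "m + j \<noteq> 0" "0 \<notin> set (butlast (pieces (m + j) (b # bs)))" by auto
  have IH: "evaluates program [Num (of_rat m + of_rat j), Num (c - of_rat j * t),
      Cell (Cell (Num t') (Num (of_rat j'))) (breaks_val bs), Cell (binomial_val B) (output_val Bs)] factors_body v
     \<longleftrightarrow> v = output_val (factors (m + j) (c - of_rat j * t) (b # bs) @ B # Bs)" for B v
    using "3.IH"[OF _ nz(2), of "B # Bs" v] b by (simp add: of_rat_add)
  have inner: "evaluates program [Num t, Num (of_rat m / (of_rat m + of_rat j))] inner_body v
      \<longleftrightarrow> v = binomial_val (inner_factor t (m / (m + j)))" for v
    using evaluates_inner[of t "m / (m + j)" v] by (simp add: of_rat_divide of_rat_add)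
  have nz': "real_of_rat m + of_rat j \<noteq> 0" using nz(1) by (metis of_rat_add of_rat_eq_0_iff)
  show ?case
    unfolding b by (subst factors_body_def) (simp add: evaluates_simps inner IH[unfolded b] nz')
qed simp

lemma evaluates_start:
  assumes "p \<noteq> []" "q \<noteq> []" "bs \<noteq> []" "0 \<notin> set (butlast (pieces (first_slope p q bs) bs))"
  shows "evaluates program [forms_val p, forms_val q, breaks_val bs] start_body v
     \<longleftrightarrow> v = output_val (factors (first_slope p q bs) (first_const p q bs) bs)"
proof -
  obtain t j bs' where bs: "bs = (t, j) # bs'" using assms(3) by (cases bs) auto
  from evaluates_factors[OF assms(3,4), of "first_const p q bs" "[]" v]
  show ?thesis
    by (subst start_body_def)
      (simp add: evaluates_simps evaluates_scan assms(1,2) scan_eq bs first_slope_def first_const_def of_rat_diff)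
qed

lemma program_yields_decomposition:
  assumes "p \<noteq> []" "q \<noteq> []" "breaks_of p q \<noteq> []"
    "0 \<notin> set (butlast (pieces (first_slope p q (breaks_of p q)) (breaks_of p q)))"
  shows "yields program (input_val p q) (output_val (decomposition p q))"
proof -
  \<comment> \<open>The initial list of crossings appears in the program as \<open>Null\<close>, not as \<open>numbers_val []\<close>.\<close>
  have "evaluates program [forms_val p, forms_val p, Null] crossings_body v \<longleftrightarrow>
      v = numbers_val (crossings p p [])" for v
    using evaluates_crossings[of p p "[]" v] by simp
  with assms show ?thesis
    unfolding yields_def input_val_def
    by (simp add: evaluates_simps main_body_def evaluates_crossings evaluates_breaks breaks_of_def[symmetric]
        evaluates_start decomposition_def Let_def)
qed

section \<open>Decomposition into binomials\<close>

theorem proposition2p1: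
  "\<exists>P :: tm list.
     (\<forall>(p :: linear_forms) (f :: real \<Rightarrow> real) (k :: nat).
        tropical_algebraic p f \<and> k = card (tropical_roots f) \<and> k \<ge> 1 \<longrightarrow>
        (\<exists>Bs. yields P (input_val p zero_form) (output_val Bs) \<and>
              length Bs = k \<and> f = compose Bs \<and>
              (\<forall>B\<in>set (tl Bs). algebraic_binomial B) \<and>
              (algebraic_binomial (hd Bs) \<or>
                 0 \<in> slopes f \<and> half_constant_binomial (hd Bs)))) \<and>
     (\<forall>(p :: linear_forms) (q :: linear_forms) (f :: real \<Rightarrow> real) (k :: nat).
        tropical_algebraic_rational p q f \<and> (tropical_increasing f \<or> tropical_decreasing f) \<and>
        k = card (tropical_roots f) \<and> k \<ge> 1 \<longrightarrow>
        (\<exists>Bs. yields P (input_val p q) (output_val Bs) \<and>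
              length Bs = k \<and> f = compose Bs \<and>
              (\<forall>B\<in>set Bs. monotone_rational_binomial B)))"
proof (intro exI[of _ program] conjI allI impI)
  fix p :: linear_forms and f :: "real \<Rightarrow> real" and k :: nat
  assume "tropical_algebraic p f \<and> k = card (tropical_roots f) \<and> k \<ge> 1"
  then have trop: "tropical_algebraic p f" and k: "k = card (tropical_roots f)" "1 \<le> card (tropical_roots f)"
    by auto
  let ?q = zero_form
  define bs where "bs = breaks_of p ?q"
  define m where "m = first_slope p ?q bs"
  have p: "p \<noteq> []" and q: "?q \<noteq> []"
    using trop by (simp_all add: tropical_algebraic_iff zero_form_def)
  have f: "f = (\<lambda>x. lower_envelope p x - lower_envelope ?q x)"
    using trop by (simp add: tropical_algebraic_iff zero_form_def lower_envelope_single)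
  note correct = decomposition_correct[OF p q f k(2), folded bs_def, folded m_def]
  have ne: "bs \<noteq> []" using correct(1) k by (auto simp: decomposition_def bs_def)
  \<comment> \<open>The zero function has no kinks, and at a kink of a minimum the slope decreases.\<close>
  have neg: "\<forall>(t, j)\<in>set bs. j < 0"
  proof safe
    fix t j assume "(t, j) \<in> set bs"
    then have "j = right_slope p t - left_slope p t" "j \<noteq> 0"
      using set_breaks_of[OF p q]
      by (auto simp: bs_def jump_def zero_form_def right_slope_def left_slope_def)
    with right_le_left_slope[OF p, of t] show "j < 0" by simp
  qed
  have nonneg: "\<forall>s\<in>set (pieces m bs). 0 \<le> s"
    using correct(2) slopes_nonneg[OF trop] by force
  note pos = concave_pieces_pos[OF neg nonneg]
  have "yields program (input_val p ?q) (output_val (decomposition p ?q))"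
    using program_yields_decomposition[OF p q, folded bs_def, folded m_def] ne pos by blast
  moreover have "0 \<in> slopes f" if "0 \<in> set (pieces m bs)"
    using that correct(2) by force
  ultimately show "\<exists>Bs. yields program (input_val p ?q) (output_val Bs) \<and>
      length Bs = k \<and> f = compose Bs \<and> (\<forall>B\<in>set (tl Bs). algebraic_binomial B) \<and>
      (algebraic_binomial (hd Bs) \<or> 0 \<in> slopes f \<and> half_constant_binomial (hd Bs))"
    using concave_factors[OF ne neg nonneg, of "first_const p ?q bs"] correct(1,3) pos k(1)
    by (intro exI[of _ "decomposition p ?q"]) (auto simp: decomposition_def Let_def bs_def m_def)
next
  fix p q :: linear_forms and f :: "real \<Rightarrow> real" and k :: nat
  assume *: "tropical_algebraic_rational p q f \<and> (tropical_increasing f \<or> tropical_decreasing f) \<and>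
    k = card (tropical_roots f) \<and> k \<ge> 1"
  then have k: "k = card (tropical_roots f)" "1 \<le> card (tropical_roots f)" by auto
  define bs where "bs = breaks_of p q"
  define m where "m = first_slope p q bs"
  from * have p: "p \<noteq> []" and q: "q \<noteq> []" and f: "f = (\<lambda>x. lower_envelope p x - lower_envelope q x)"
    by (auto simp: tropical_algebraic_rational_def tropical_algebraic_iff)
  note correct = decomposition_correct[OF p q f k(2), folded bs_def, folded m_def]
  have ne: "bs \<noteq> []" using correct(1) k by (auto simp: decomposition_def bs_def)
  have signs: "(\<forall>s\<in>set (pieces m bs). 0 < s) \<or> (\<forall>s\<in>set (pieces m bs). s < 0)"
    using * correct(2) unfolding tropical_increasing_def tropical_decreasing_def by force
  then have signs': "(\<forall>s\<in>set (butlast (pieces m bs)). 0 < s) \<or> (\<forall>s\<in>set (butlast (pieces m bs)). s < 0)"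
    using in_set_butlastD by fast
  have "\<forall>(t, j)\<in>set bs. j \<noteq> 0" using set_breaks_of[OF p q] by (auto simp: bs_def)
  from monotone_factors[OF this signs] have "\<forall>B\<in>set (decomposition p q). monotone_rational_binomial B"
    by (simp add: decomposition_def Let_def bs_def m_def)
  moreover have "yields program (input_val p q) (output_val (decomposition p q))"
    using program_yields_decomposition[OF p q, folded bs_def, folded m_def] ne signs' by blast
  ultimately show "\<exists>Bs. yields program (input_val p q) (output_val Bs) \<and>
      length Bs = k \<and> f = compose Bs \<and> (\<forall>B\<in>set Bs. monotone_rational_binomial B)"
    using correct(1,3) signs' k(1) by (intro exI[of _ "decomposition p q"]) auto
qed

end
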